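(* Let $G$ be a $d$-regular graph with $d\geq 3$. Then $\overset{\rightarrow}{\gamma}_{LD}(G)\leq\alpha'(G)$, where $\alpha'(G)$ is the maximum size of a matching in $G$.
   Context: For an orientation $D$ of a graph $G=(V,E)$ (each edge given exactly one direction), a set $S\subseteq V$ is locating-dominating in $D$ if every $u\notin S$ has an in-neighbour in $S$ and distinct $u,v\notin S$ have distinct sets of in-neighbours in $S$; $\gamma_{LD}(D)$ is the minimum size of such a set. $\overset{\rightarrow}{\gamma}_{LD}(G)$ is the minimum of $\gamma_{LD}(D)$ over all orientations $D$ of $G$. *)

theory Defs
  imports Main
begin

definition simple_graph :: "'a set \<Rightarrow> 'a set set \<Rightarrow> bool" where
  "simple_graph V E \<longleftrightarrow> finite V \<and> (\<forall>e\<in>E. e \<subseteq> V \<and> card e = 2)"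

definition vertex_degree :: "'a set set \<Rightarrow> 'a \<Rightarrow> nat" where
  "vertex_degree E v = card {e \<in> E. v \<in> e}"

definition regular_graph :: "'a set \<Rightarrow> 'a set set \<Rightarrow> nat \<Rightarrow> bool" where
  "regular_graph V E d \<longleftrightarrow> simple_graph V E \<and> (\<forall>v\<in>V. vertex_degree E v = d)"

definition matching :: "'a set set \<Rightarrow> 'a set set \<Rightarrow> bool" where
  "matching E M \<longleftrightarrow> M \<subseteq> E \<and> (\<forall>e\<in>M. \<forall>f\<in>M. e \<noteq> f \<longrightarrow> e \<inter> f = {})"

definition matching_number :: "'a set set \<Rightarrow> nat" where
  "matching_number E = Max (card ` {M. matching E M})"

(* A pair (u, v) in D is an arc from u to v. *)
definition orientation :: "'a set set \<Rightarrow> ('a \<times> 'a) set \<Rightarrow> bool" where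
  "orientation E D \<longleftrightarrow>
     (\<forall>u v. (u, v) \<in> D \<longrightarrow> {u, v} \<in> E) \<and>
     (\<forall>u v. {u, v} \<in> E \<longrightarrow> ((u, v) \<in> D \<longleftrightarrow> (v, u) \<notin> D))"

definition in_neighbours :: "('a \<times> 'a) set \<Rightarrow> 'a \<Rightarrow> 'a set" where
  "in_neighbours D v = {u. (u, v) \<in> D}"

definition locating_dominating :: "'a set \<Rightarrow> ('a \<times> 'a) set \<Rightarrow> 'a set \<Rightarrow> bool" where
  "locating_dominating V D S \<longleftrightarrow>
     S \<subseteq> V \<and>
     (\<forall>u \<in> V - S. in_neighbours D u \<inter> S \<noteq> {}) \<and>
     (\<forall>u \<in> V - S. \<forall>v \<in> V - S. u \<noteq> v \<longrightarrow>
        in_neighbours D u \<inter> S \<noteq> in_neighbours D v \<inter> S)"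

definition gamma_LD :: "'a set \<Rightarrow> ('a \<times> 'a) set \<Rightarrow> nat" where
  "gamma_LD V D = Min (card ` {S. locating_dominating V D S})"

definition oriented_gamma_LD :: "'a set \<Rightarrow> 'a set set \<Rightarrow> nat" where
  "oriented_gamma_LD V E = Min (gamma_LD V ` {D. orientation E D})"

(* The sets over which Min and Max are taken above are finite and nonempty for
   every simple graph, so these extrema are attained. *)

lemma simple_graph_finite_edges:
  assumes "simple_graph V E" shows "finite E"
proof -
  have "E \<subseteq> Pow V" using assms by (auto simp: simple_graph_def)
  then show ?thesis using assms by (auto simp: simple_graph_def intro: finite_subset)
qed

lemma matching_number_attained:
  assumes "simple_graph V E"
  shows "finite {M. matching E M}" and "{M. matching E M} \<noteq> {}"
proof -
  have "{M. matching E M} \<subseteq> Pow E" by (auto simp: matching_def)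
  then show "finite {M. matching E M}"
    using simple_graph_finite_edges[OF assms] by (auto intro: finite_subset)
  have "matching E {}" by (simp add: matching_def)
  then show "{M. matching E M} \<noteq> {}" by blast
qed

lemma gamma_LD_attained:
  assumes "finite V"
  shows "finite {S. locating_dominating V D S}" and "{S. locating_dominating V D S} \<noteq> {}"
proof -
  have "{S. locating_dominating V D S} \<subseteq> Pow V" by (auto simp: locating_dominating_def)
  then show "finite {S. locating_dominating V D S}" using assms by (auto intro: finite_subset)
  have "locating_dominating V D V" by (simp add: locating_dominating_def)
  then show "{S. locating_dominating V D S} \<noteq> {}" by blast
qed

lemma oriented_gamma_LD_attained:
  assumes "simple_graph V E"
  shows "finite {D. orientation E D}" and "{D. orientation E D} \<noteq> {}"
proof -
  have V: "finite V" and E: "\<And>u v. {u, v} \<in> E \<Longrightarrow> u \<in> V \<and> v \<in> V \<and> u \<noteq> v"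
    using assms by (fastforce simp: simple_graph_def)+
  have "{D. orientation E D} \<subseteq> Pow (V \<times> V)" using E by (auto simp: orientation_def)
  then show "finite {D. orientation E D}" using V by (auto intro: finite_subset)
  obtain f :: "'a \<Rightarrow> nat" where f: "inj_on f V"
    using finite_imp_inj_to_nat_seg[OF V] by blast
  have *: "f u < f v \<longleftrightarrow> \<not> f v < f u" if "{u, v} \<in> E" for u v
    using E[OF that] inj_onD[OF f, of u v] by (metis less_asym linorder_neqE_nat)
  have sym: "{u, v} \<in> E \<longleftrightarrow> {v, u} \<in> E" for u v
    by (simp add: insert_commute)
  have "orientation E {(u, v). {u, v} \<in> E \<and> f u < f v}"
    unfolding orientation_def using * sym by blast
  then show "{D. orientation E D} \<noteq> {}" by blast
qed

end

theory Submission
  imports Defs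
begin

text \<open>
  Only the arcs between \<open>S\<close> and its complement matter, and they can be chosen independently: it
  suffices to find \<open>S\<close> and to give the vertices outside \<open>S\<close> distinct nonempty sets of neighbours
  in \<open>S\<close>. Let \<open>M\<close> be a maximum matching and \<open>U\<close> the set of uncovered vertices, and let \<open>S\<close> contain
  one endpoint of each edge of \<open>M\<close>, one with a neighbour in \<open>U\<close> if there is any. A covered vertex
  outside \<open>S\<close> gets its partner as a singleton, so the vertices of \<open>U\<close> need distinct pairs. As \<open>M\<close>
  has no augmenting path of length 3, a vertex \<open>u \<in> U\<close> with a neighbour outside \<open>S\<close> has a neighbour
  \<open>p \<in> S\<close> whose only neighbour in \<open>U\<close> is \<open>u\<close>, and any pair containing \<open>p\<close> will do. The other
  vertices of \<open>U\<close> have \<open>d choose 2 \<ge> d\<close> pairs to choose from, whereas each pair is available to at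
  most \<open>d\<close> of them, so Hall's theorem applies.
\<close>

section \<open>Hall's theorem\<close>

text \<open>Induction on \<open>I\<close> with two cases. If some nonempty proper subfamily
  \<open>J\<close> is tight, represent \<open>J\<close> first and remove its whole union from the
  remaining sets. If every nonempty proper subfamily has a surplus, any element may represent one
  chosen index.\<close>

theorem hall:
  assumes "finite I" "\<And>i. i \<in> I \<Longrightarrow> finite (A i)"
    and "\<And>J. J \<subseteq> I \<Longrightarrow> card J \<le> card (\<Union>(A ` J))"
  shows "\<exists>R. inj_on R I \<and> (\<forall>i\<in>I. R i \<in> A i)"
  using assms
proof (induction I arbitrary: A rule: finite_psubset_induct)
  case (psubset I)
  have finU: "finite (\<Union>(A ` J))" if "J \<subseteq> I" for J
    using that finite_subset[OF that psubset.hyps] psubset.prems(1) by (intro finite_UN_I) blast+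
  consider "I = {}"
    | J where "J \<subset> I" "J \<noteq> {}" "card (\<Union>(A ` J)) = card J"
    | "I \<noteq> {}" "\<And>J. J \<subset> I \<Longrightarrow> J \<noteq> {} \<Longrightarrow> card J < card (\<Union>(A ` J))"
    using psubset.prems(2) by (metis le_neq_implies_less psubset_imp_subset)
  then show ?case
  proof cases
    case 1
    then show ?thesis by simp
  next
    case 2
    define T where "T = \<Union>(A ` J)"
    have finT: "finite T" using finU 2 unfolding T_def by blast
    obtain R where R: "inj_on R J" "\<forall>i\<in>J. R i \<in> A i"
      using psubset.IH[OF \<open>J \<subset> I\<close>, of A] psubset.prems \<open>J \<subset> I\<close> by (metis psubset_imp_subset psubsetD subset_trans)
    \<comment> \<open>Hall's condition survives the removal of \<open>T\<close>: the family
      \<open>K \<union> J\<close> covers at least \<open>card K + card J\<close> elements, and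
      tightness puts exactly \<open>card J\<close> of them in \<open>T\<close>.\<close>
    have "card K \<le> card (\<Union>((\<lambda>i. A i - T) ` K))" if K: "K \<subseteq> I - J" for K
    proof -
      have fin: "finite K" "finite J"
        using K 2 psubset.hyps by (auto intro: finite_subset)
      have fK: "finite (\<Union>((\<lambda>i. A i - T) ` K))"
        using K finU[of K] by (auto elim: finite_subset[rotated])
      have "card K + card J = card (K \<union> J)"
        using K fin by (subst card_Un_disjoint) auto
      also have "\<dots> \<le> card (\<Union>(A ` (K \<union> J)))"
        by (rule psubset.prems(2)) (use K \<open>J \<subset> I\<close> in blast)
      also have "\<Union>(A ` (K \<union> J)) = \<Union>((\<lambda>i. A i - T) ` K) \<union> T"
        by (auto simp: T_def)
      also have "card \<dots> = card (\<Union>((\<lambda>i. A i - T) ` K)) + card T"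
        using fK finT by (intro card_Un_disjoint) auto
      finally show ?thesis using 2 by (simp add: T_def)
    qed
    moreover have "I - J \<subset> I" using 2 by blast
    ultimately obtain Q where Q: "inj_on Q (I - J)" "\<forall>i\<in>I - J. Q i \<in> A i - T"
      using psubset.IH[of "I - J" "\<lambda>i. A i - T"] psubset.prems(1) by (metis DiffD1 finite_Diff)
    have RT: "R i \<in> T" if "i \<in> J" for i using R that by (auto simp: T_def)
    have QT: "Q i \<notin> T" if "i \<in> I - J" for i using Q that by blast
    have "inj_on (\<lambda>i. if i \<in> J then R i else Q i) I"
    proof (rule inj_onI)
      fix i j
      assume ij: "i \<in> I" "j \<in> I" "(if i \<in> J then R i else Q i) = (if j \<in> J then R j else Q j)"
      then show "i = j"
        using R(1) Q(1) RT[of i] RT[of j] QT[of i] QT[of j]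
        by (cases "i \<in> J"; cases "j \<in> J") (auto dest: inj_onD)
    qed
    moreover have "\<forall>i\<in>I. (if i \<in> J then R i else Q i) \<in> A i" using R Q by auto
    ultimately show ?thesis by blast
  next
    case 3
    then obtain i where i: "i \<in> I" by blast
    have "card {i} \<le> card (A i)" using psubset.prems(2)[of "{i}"] i by simp
    then obtain x where x: "x \<in> A i" by fastforce
    \<comment> \<open>Removing \<open>x\<close> costs at most one element, which the strict surplus
      pays for.\<close>
    have "card K \<le> card (\<Union>((\<lambda>j. A j - {x}) ` K))" if K: "K \<subseteq> I - {i}" for K
    proof (cases "K = {}")
      case False
      have "card K < card (\<Union>(A ` K))" by (rule 3(2)) (use K i False in blast)+
      moreover have "\<Union>((\<lambda>j. A j - {x}) ` K) = \<Union>(A ` K) - {x}" by auto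
      ultimately show ?thesis by (simp only: card_Diff_singleton_if split: if_split) linarith
    qed simp
    moreover have "I - {i} \<subset> I" using i by blast
    ultimately obtain Q where Q: "inj_on Q (I - {i})" "\<forall>j\<in>I - {i}. Q j \<in> A j - {x}"
      using psubset.IH[of "I - {i}" "\<lambda>j. A j - {x}"] psubset.prems(1) by (metis DiffD1 finite_Diff)
    have "inj_on (Q(i := x)) (I - {i})"
      using Q(1) by (rule inj_on_cong[THEN iffD1, rotated]) simp
    then have "inj_on (Q(i := x)) (insert i (I - {i}))"
      unfolding inj_on_insert using Q(2) by auto
    then have "inj_on (Q(i := x)) I" by (simp only: insert_Diff[OF i])
    moreover have "\<forall>j\<in>I. (Q(i := x)) j \<in> A j" using Q x by auto
    ultimately show ?thesis by blast
  qed
qed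

text \<open>Double counting of the incidences between \<open>J\<close> and its union
  \<open>T\<close>: there are at least \<open>k * card J\<close> and at most
  \<open>k * card T\<close> of them, which gives Hall's condition after cancelling
  \<open>k\<close>.\<close>

corollary hall_degree:
  assumes "finite I" "\<And>i. i \<in> I \<Longrightarrow> finite (A i)" "0 < k"
    and deg: "\<And>i. i \<in> I \<Longrightarrow> k \<le> card (A i)"
    and codeg: "\<And>x. card {i \<in> I. x \<in> A i} \<le> k"
  shows "\<exists>R. inj_on R I \<and> (\<forall>i\<in>I. R i \<in> A i)"
proof (rule hall)
  fix J assume J: "J \<subseteq> I"
  then have finJ: "finite J" using assms(1) finite_subset by blast
  define T where "T = \<Union>(A ` J)"
  have finT: "finite T" using J assms(2) finJ by (auto simp: T_def)
  have "card J * k = (\<Sum>i\<in>J. k)" by simp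
  also have "\<dots> \<le> (\<Sum>i\<in>J. card (A i))" using J deg by (intro sum_mono) blast
  also have "\<dots> = (\<Sum>i\<in>J. card {x \<in> T. x \<in> A i})"
    by (intro sum.cong refl arg_cong[where f = card]) (auto simp: T_def)
  also have "\<dots> = (\<Sum>x\<in>T. card {i \<in> J. x \<in> A i})"
    using sum_multicount_gen[OF finJ finT, of "\<lambda>i x. x \<in> A i" "\<lambda>x. card {i \<in> J. x \<in> A i}"]
    by simp
  also have "\<dots> \<le> (\<Sum>x\<in>T. k)"
  proof (rule sum_mono)
    fix x
    have "card {i \<in> J. x \<in> A i} \<le> card {i \<in> I. x \<in> A i}"
      using J assms(1) by (intro card_mono) auto
    then show "card {i \<in> J. x \<in> A i} \<le> k" using codeg[of x] by linarith
  qed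
  also have "\<dots> = card T * k" by simp
  finally show "card J \<le> card (\<Union>(A ` J))" using \<open>0 < k\<close> by (simp add: T_def)
qed (use assms in auto)

lemma distinct_pairs:
  assumes "finite W" "3 \<le> d"
    and N: "\<And>u. u \<in> W \<Longrightarrow> finite (N u)" "\<And>u. u \<in> W \<Longrightarrow> d \<le> card (N u)"
    and codeg: "\<And>p. card {u \<in> W. p \<in> N u} \<le> d"
  shows "\<exists>R. inj_on R W \<and> (\<forall>u\<in>W. R u \<subseteq> N u \<and> card (R u) = 2)"
proof -
  have "\<exists>R. inj_on R W \<and> (\<forall>u\<in>W. R u \<in> {P. P \<subseteq> N u \<and> card P = 2})"
  proof (rule hall_degree)
    show "finite {P. P \<subseteq> N u \<and> card P = 2}" if "u \<in> W" for u using N(1)[OF that] by simp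
    show "0 < d" using assms(2) by simp
    show "d \<le> card {P. P \<subseteq> N u \<and> card P = 2}" if "u \<in> W" for u
    proof -
      \<comment> \<open>This is where \<open>3 \<le> d\<close> enters: it makes the second factor at
        least 2, so a set of at least \<open>d\<close> elements has at least \<open>d\<close>
        pairs.\<close>
      have "d * 2 \<le> card (N u) * (card (N u) - 1)"
        using N(2)[OF that] assms(2) by (intro mult_le_mono) linarith+
      then have "d \<le> card (N u) choose 2" unfolding choose_two by linarith
      then show ?thesis using N(1)[OF that] by (simp add: n_subsets)
    qed
    show "card {u \<in> W. P \<in> {P. P \<subseteq> N u \<and> card P = 2}} \<le> d" for P
    proof (cases "P = {}")
      case True
      then show ?thesis by simp
    next
      case False
      then obtain p where "p \<in> P" by blast
      \<comment> \<open>One element of the pair already bounds the number of vertices that can use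
        it.\<close>
      then have "{u \<in> W. P \<in> {P. P \<subseteq> N u \<and> card P = 2}} \<subseteq> {u \<in> W. p \<in> N u}" by blast
      then have "card {u \<in> W. P \<in> {P. P \<subseteq> N u \<and> card P = 2}} \<le> card {u \<in> W. p \<in> N u}"
        using \<open>finite W\<close> by (intro card_mono) auto
      then show ?thesis using codeg[of p] by linarith
    qed
  qed fact
  then show ?thesis by simp
qed

section \<open>Graphs and locating-dominating sets\<close>

lemma simple_graph_edgeD:
  assumes "simple_graph V E" "{u, v} \<in> E"
  shows "u \<in> V" "v \<in> V" "u \<noteq> v"
  using assms by (fastforce simp: simple_graph_def)+

lemma simple_graph_edge_other_end:
  assumes "simple_graph V E" "e \<in> E" "x \<in> e"
  obtains y where "e = {x, y}" "x \<noteq> y"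
proof -
  have "card e = 2" using assms by (auto simp: simple_graph_def)
  then show thesis using that assms(3) by (auto simp: card_2_iff insert_commute)
qed

lemma vertex_degree_eq_card_neighbours:
  assumes "simple_graph V E"
  shows "vertex_degree E v = card {w. {v, w} \<in> E}"
proof -
  have "bij_betw (\<lambda>w. {v, w}) {w. {v, w} \<in> E} {e \<in> E. v \<in> e}"
  proof (rule bij_betw_imageI)
    show "inj_on (\<lambda>w. {v, w}) {w. {v, w} \<in> E}"
      by (auto simp: inj_on_def doubleton_eq_iff)
    show "(\<lambda>w. {v, w}) ` {w. {v, w} \<in> E} = {e \<in> E. v \<in> e}"
      using simple_graph_edge_other_end[OF assms, of _ v] by (auto simp: image_iff)
  qed
  then show ?thesis by (simp add: vertex_degree_def bij_betw_same_card)
qed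

text \<open>An edge between \<open>S\<close> and its complement has exactly one end \<open>v\<close>
  outside \<open>S\<close>, so \<open>I v\<close> can dictate its direction without conflict. All
  in-neighbourhoods traced on \<open>S\<close> can thus be prescribed at once.\<close>

lemma oriented_gamma_LD_le:
  assumes G: "simple_graph V E" and "S \<subseteq> V"
    and edge: "\<And>v s. v \<in> V - S \<Longrightarrow> s \<in> I v \<Longrightarrow> s \<in> S \<and> {s, v} \<in> E"
    and ne: "\<And>v. v \<in> V - S \<Longrightarrow> I v \<noteq> {}"
    and inj: "inj_on I (V - S)"
  shows "oriented_gamma_LD V E \<le> card S"
proof -
  obtain D0 where D0: "orientation E D0"
    using oriented_gamma_LD_attained(2)[OF G] by blast
  \<comment> \<open>The second branch negates the first with the ends exchanged, so exactly one of
    the two arcs is chosen. Edges with both ends on the same side follow the arbitrary orientation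
    \<open>D0\<close>.\<close>
  define D where "D = {(x, y). {x, y} \<in> E \<and>
    (if x \<in> S \<and> y \<notin> S then x \<in> I y else if x \<notin> S \<and> y \<in> S then y \<notin> I x else (x, y) \<in> D0)}"
  have "orientation E D"
    unfolding orientation_def
  proof (intro conjI allI impI)
    fix u v
    show "{u, v} \<in> E" if "(u, v) \<in> D" using that by (simp add: D_def)
    assume uv: "{u, v} \<in> E"
    then have vu: "{v, u} \<in> E" by (simp add: insert_commute)
    have "(u, v) \<in> D0 \<longleftrightarrow> (v, u) \<notin> D0" using D0 uv by (simp add: orientation_def)
    then show "(u, v) \<in> D \<longleftrightarrow> (v, u) \<notin> D"
      using uv vu by (cases "u \<in> S"; cases "v \<in> S") (simp_all add: D_def)
  qed
  have in_D: "in_neighbours D v \<inter> S = I v" if "v \<in> V - S" for v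
    using that edge[OF that] by (auto simp: in_neighbours_def D_def)
  have "locating_dominating V D S"
    unfolding locating_dominating_def
  proof (intro conjI ballI impI)
    show "in_neighbours D u \<inter> S \<noteq> {}" if "u \<in> V - S" for u
      using ne[OF that] by (simp only: in_D[OF that] not_False_eq_True)
    show "in_neighbours D u \<inter> S \<noteq> in_neighbours D v \<inter> S"
      if "u \<in> V - S" "v \<in> V - S" "u \<noteq> v" for u v
      using inj_onD[OF inj _ that(1,2)] that(3) unfolding in_D[OF that(1)] in_D[OF that(2)] by blast
  qed fact
  have "finite V" using G by (simp add: simple_graph_def)
  have "oriented_gamma_LD V E \<le> gamma_LD V D"
    using \<open>orientation E D\<close> oriented_gamma_LD_attained(1)[OF G]
    by (auto simp: oriented_gamma_LD_def intro: Min_le)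
  also have "\<dots> \<le> card S"
    using \<open>locating_dominating V D S\<close> gamma_LD_attained(1)[OF \<open>finite V\<close>]
    by (auto simp: gamma_LD_def intro: Min_le)
  finally show ?thesis .
qed

section \<open>Maximum matchings\<close>

lemma obtain_maximum_matching:
  assumes "simple_graph V E"
  obtains M where "matching E M" "card M = matching_number E"
    "\<And>M'. matching E M' \<Longrightarrow> card M' \<le> card M"
proof -
  note att = matching_number_attained[OF assms]
  have "matching_number E \<in> card ` {M. matching E M}"
    unfolding matching_number_def using att by (intro Max_in) auto
  moreover have "card M' \<le> matching_number E" if "matching E M'" for M'
    unfolding matching_number_def using att that by (intro Max_ge) auto
  ultimately show thesis using that by auto
qed

lemma matching_eqI: "matching E M \<Longrightarrow> e \<in> M \<Longrightarrow> f \<in> M \<Longrightarrow> x \<in> e \<Longrightarrow> x \<in> f \<Longrightarrow> e = f"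
  unfolding matching_def by blast

lemma matching_insert:
  "matching E M \<Longrightarrow> e \<in> E \<Longrightarrow> e \<inter> \<Union>M = {} \<Longrightarrow> matching E (insert e M)"
  unfolding matching_def by auto

text \<open>An edge with both ends uncovered could be added to \<open>M\<close>.\<close>

lemma maximum_matching_covers_edge:
  assumes "finite E" "matching E M"
    and max: "\<And>M'. matching E M' \<Longrightarrow> card M' \<le> card M"
    and "{u, w} \<in> E" "u \<notin> \<Union>M"
  shows "w \<in> \<Union>M"
proof (rule ccontr)
  assume "w \<notin> \<Union>M"
  then have "matching E (insert {u, w} M)"
    using assms by (intro matching_insert) auto
  moreover have "finite M" using assms by (auto simp: matching_def intro: finite_subset)
  moreover have "{u, w} \<notin> M" using assms by blast
  ultimately show False using max[of "insert {u, w} M"] by simp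
qed

text \<open>If \<open>u\<close> and \<open>v\<close> were distinct, exchanging \<open>{x, y}\<close>
  for \<open>{u, x}\<close> and \<open>{v, y}\<close> would enlarge \<open>M\<close>.\<close>

lemma maximum_matching_no_augmenting_path:
  assumes "simple_graph V E" "matching E M"
    and max: "\<And>M'. matching E M' \<Longrightarrow> card M' \<le> card M"
    and xy: "{x, y} \<in> M" and ux: "{u, x} \<in> E" and vy: "{v, y} \<in> E"
    and u: "u \<notin> \<Union>M" and v: "v \<notin> \<Union>M"
  shows "u = v"
proof (rule ccontr)
  assume "u \<noteq> v"
  have finM: "finite M"
    using assms(2) simple_graph_finite_edges[OF assms(1)]
    by (auto simp: matching_def intro: finite_subset)
  have "x \<noteq> y" using simple_graph_edgeD(3)[OF assms(1)] xy assms(2) by (auto simp: matching_def)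
  have away: "x \<notin> e" "y \<notin> e" if "e \<in> M - {{x, y}}" for e
    using that xy matching_eqI[OF assms(2)] by blast+
  have uv: "{u, x} \<inter> {v, y} = {}" using \<open>u \<noteq> v\<close> \<open>x \<noteq> y\<close> u v xy by blast
  have off: "{u, x} \<inter> \<Union>(M - {{x, y}}) = {}" "{v, y} \<inter> \<Union>(M - {{x, y}}) = {}"
    using away u v by blast+
  have "matching E (M - {{x, y}})" using assms(2) by (auto simp: matching_def)
  then have "matching E (insert {v, y} (M - {{x, y}}))" using vy off(2) by (rule matching_insert)
  moreover have "{u, x} \<inter> \<Union>(insert {v, y} (M - {{x, y}})) = {}"
    using uv off(1) by (simp only: Union_insert Int_Un_distrib Un_empty_left)
  ultimately have "matching E (insert {u, x} (insert {v, y} (M - {{x, y}})))"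
    by (rule matching_insert[OF _ ux])
  then have "card (insert {u, x} (insert {v, y} (M - {{x, y}}))) \<le> card M" by (rule max)
  moreover have "{v, y} \<notin> M - {{x, y}}" using away(2)[of "{v, y}"] by blast
  moreover have "{u, x} \<noteq> {v, y}" using uv by blast
  then have "{u, x} \<notin> insert {v, y} (M - {{x, y}})" using away(1)[of "{u, x}"] by blast
  ultimately show False using finM xy card_Suc_Diff1[OF finM xy] by simp
qed

section \<open>Orientations built from a matching with one representative per edge\<close>

definition matching_edge :: "'a set set \<Rightarrow> 'a \<Rightarrow> 'a set" where
  "matching_edge M v = (THE e. e \<in> M \<and> v \<in> e)"

lemma matching_edge:
  assumes "matching E M" "v \<in> \<Union>M"
  shows "matching_edge M v \<in> M" "v \<in> matching_edge M v"
proof -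
  have "\<exists>!e. e \<in> M \<and> v \<in> e" using assms(2) matching_eqI[OF assms(1)] by blast
  then have "matching_edge M v \<in> M \<and> v \<in> matching_edge M v"
    unfolding matching_edge_def by (rule theI')
  then show "matching_edge M v \<in> M" "v \<in> matching_edge M v" by simp_all
qed

text \<open>Identifies the partner of a covered non-representative as the representative of its
  edge, so that this singleton is an admissible in-neighbourhood.\<close>

lemma matching_edge_eq_representative:
  assumes "simple_graph V E" "matching E M" and r: "\<And>e. e \<in> M \<Longrightarrow> r e \<in> e"
    and v: "v \<in> \<Union>M" "v \<notin> r ` M"
  shows "matching_edge M v = {r (matching_edge M v), v}"
proof -
  note mv = matching_edge[OF assms(2) v(1)]
  have "matching_edge M v \<in> E" using mv(1) assms(2) by (auto simp: matching_def)
  then obtain y where "matching_edge M v = {v, y}"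
    using mv(2) by (rule simple_graph_edge_other_end[OF assms(1)])
  moreover have "r (matching_edge M v) \<noteq> v" using mv(1) v(2) by (metis imageI)
  moreover have "r (matching_edge M v) \<in> matching_edge M v" using r mv(1) by blast
  ultimately show ?thesis by auto
qed

lemma oriented_gamma_LD_le_card_matching:
  assumes G: "simple_graph V E" and M: "matching E M"
    and r: "\<And>e. e \<in> M \<Longrightarrow> r e \<in> e"
    and P: "\<And>u s. u \<in> V - \<Union>M \<Longrightarrow> s \<in> P u \<Longrightarrow> s \<in> r ` M \<and> {s, u} \<in> E"
    and P2: "\<And>u. u \<in> V - \<Union>M \<Longrightarrow> card (P u) = 2"
    and P_inj: "inj_on P (V - \<Union>M)"
  shows "oriented_gamma_LD V E \<le> card M"
proof -
  define m where "m = matching_edge M"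
  define I where "I v = (if v \<in> \<Union>M then {r (m v)} else P v)" for v
  have ME: "M \<subseteq> E" using M by (simp add: matching_def)
  have m: "m v \<in> M" if "v \<in> \<Union>M" for v
    using matching_edge[OF M that] by (simp add: m_def)
  have m_eq: "m v = {r (m v), v}" if "v \<in> \<Union>M" "v \<notin> r ` M" for v
    using matching_edge_eq_representative[OF G M r that] by (simp add: m_def)
  have "oriented_gamma_LD V E \<le> card (r ` M)"
  proof (rule oriented_gamma_LD_le[OF G, of _ I])
    show "r ` M \<subseteq> V" using r ME G by (fastforce simp: simple_graph_def)
  next
    fix v s assume v: "v \<in> V - r ` M" and s: "s \<in> I v"
    show "s \<in> r ` M \<and> {s, v} \<in> E"
    proof (cases "v \<in> \<Union>M")
      case True
      then have "s = r (m v)" using s by (simp add: I_def)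
      moreover have "m v = {r (m v), v}" using m_eq True v by blast
      ultimately show ?thesis using m[OF True] ME by auto
    next
      case False
      then show ?thesis using P[of v s] v s unfolding I_def by simp
    qed
  next
    show "I v \<noteq> {}" if "v \<in> V - r ` M" for v
      using P2[of v] that by (auto simp: I_def)
  next
    show "inj_on I (V - r ` M)"
    proof (rule inj_onI)
      fix v w assume v: "v \<in> V - r ` M" and w: "w \<in> V - r ` M" and eq: "I v = I w"
      have card_I: "card (I x) = (if x \<in> \<Union>M then 1 else 2)" if "x \<in> V" for x
        using that P2[of x] by (auto simp: I_def)
      have "card (I v) = card (I w)" by (simp only: eq)
      then have "(if v \<in> \<Union>M then 1 else 2) = (if w \<in> \<Union>M then 1 else (2::nat))"
        using v w card_I by (metis DiffD1)
      then have sync: "v \<in> \<Union>M \<longleftrightarrow> w \<in> \<Union>M" by (simp split: if_splits)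
      show "v = w"
      proof (cases "v \<in> \<Union>M")
        case True
        then have wM: "w \<in> \<Union>M" using sync by simp
        then have rr: "r (m v) = r (m w)" using True eq by (simp add: I_def)
        then have "m v = m w"
          using matching_eqI[OF M] m[OF True] m[OF wM] r by metis
        moreover have "m v = {r (m v), v}" "m w = {r (m w), w}" using m_eq True wM v w by blast+
        ultimately show ?thesis by (metis doubleton_eq_iff)
      next
        case False
        then have "P v = P w" using sync eq unfolding I_def by simp
        then show ?thesis using inj_onD[OF P_inj] False sync v w by blast
      qed
    qed
  qed
  also have "\<dots> \<le> card M"
    using simple_graph_finite_edges[OF G] ME by (auto intro: card_image_le finite_subset)
  finally show ?thesis .
qed

section \<open>Regular graphs\<close>

theorem theorem28:
  fixes V :: "'a set" and E :: "'a set set" and d :: nat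
  assumes "regular_graph V E d" and "d \<ge> 3"
  shows "oriented_gamma_LD V E \<le> matching_number E"
proof -
  have G: "simple_graph V E" and finV: "finite V"
    using assms by (auto simp: regular_graph_def simple_graph_def)
  have finE: "finite E" using simple_graph_finite_edges[OF G] .
  define N where "N v = {w. {v, w} \<in> E}" for v
  have N_sub: "N v \<subseteq> V" for v using simple_graph_edgeD[OF G] by (auto simp: N_def)
  have finN: "finite (N v)" for v using N_sub finV finite_subset by blast
  have N_sym: "v \<in> N w \<longleftrightarrow> w \<in> N v" for v w by (simp add: N_def insert_commute)
  have card_N: "card (N v) = d" if "v \<in> V" for v
    using that assms vertex_degree_eq_card_neighbours[OF G, of v]
    by (simp add: regular_graph_def N_def)
  obtain M where M: "matching E M" "card M = matching_number E"
    and max: "\<And>M'. matching E M' \<Longrightarrow> card M' \<le> card M"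
    using obtain_maximum_matching[OF G] by blast
  have ME: "M \<subseteq> E" using M(1) by (simp add: matching_def)
  define U where "U = V - \<Union>M"
  have N_cov: "w \<in> \<Union>M" if "u \<in> U" "w \<in> N u" for u w
    using maximum_matching_covers_edge[OF finE M(1) max, of u w] that by (auto simp: U_def N_def)

  \<comment> \<open>The representative is an end with a neighbour in \<open>U\<close> if there is
    one, and any end otherwise; the implication covers both cases.\<close>
  have "\<exists>x\<in>e. \<forall>y\<in>e. N y \<inter> U \<noteq> {} \<longrightarrow> N x \<inter> U \<noteq> {}" if "e \<in> M" for e
  proof -
    have "card e = 2" using that ME G by (auto simp: simple_graph_def)
    then have "e \<noteq> {}" by auto
    then show ?thesis by blast
  qed
  then obtain r where r: "\<And>e. e \<in> M \<Longrightarrow> r e \<in> e"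
    and r_adj: "\<And>e y. e \<in> M \<Longrightarrow> y \<in> e \<Longrightarrow> N y \<inter> U \<noteq> {} \<Longrightarrow> N (r e) \<inter> U \<noteq> {}"
    by metis
  define S where "S = r ` M"
  have S_cov: "S \<subseteq> \<Union>M" using r by (auto simp: S_def)
  have r_unique: "s = r e" if "s \<in> S" "s \<in> e" "e \<in> M" for s e
    using that r matching_eqI[OF M(1)] unfolding S_def by fastforce

  define m where "m = matching_edge M"
  have m: "m v \<in> M" "v \<in> m v" if "v \<in> \<Union>M" for v
    using matching_edge[OF M(1) that] by (simp_all add: m_def)
  have r_m_S: "r (m v) \<in> S" if "v \<in> \<Union>M" for v using m(1)[OF that] by (simp add: S_def)
  have m_eq: "m v = {r (m v), v}" if "v \<in> \<Union>M" "v \<notin> S" for v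
    using matching_edge_eq_representative[OF G M(1) r] that unfolding m_def S_def by blast

  \<comment> \<open>If \<open>w \<in> S\<close>, then \<open>w\<close> is itself the representative.
    Otherwise the representative has a neighbour in \<open>U\<close> by the choice of
    \<open>r\<close>, and any such neighbour other than \<open>u\<close> would close an augmenting
    path through \<open>m w\<close>.\<close>
  have r_N: "r (m w) \<in> N u \<inter> S" and r_priv: "w \<notin> S \<Longrightarrow> N (r (m w)) \<inter> U = {u}"
    if uw: "u \<in> U" "w \<in> N u" for u w
  proof -
    have w: "w \<in> \<Union>M" using N_cov uw by blast
    have priv: "N (r (m w)) \<inter> U = {u}" if "w \<notin> S"
    proof -
      have wE: "{r (m w), w} \<in> M" using m(1)[OF w] m_eq[OF w that] by simp
      have "v = u" if "v \<in> N (r (m w)) \<inter> U" for v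
        using maximum_matching_no_augmenting_path[OF G M(1) max wE, of v u] that uw
        by (auto simp: N_def U_def insert_commute)
      moreover have "N (r (m w)) \<inter> U \<noteq> {}"
        using r_adj[OF m[OF w]] uw N_sym by blast
      ultimately show ?thesis by blast
    qed
    then show "w \<notin> S \<Longrightarrow> N (r (m w)) \<inter> U = {u}" .
    show "r (m w) \<in> N u \<inter> S"
    proof (cases "w \<in> S")
      case True
      then have "w = r (m w)" using r_unique m[OF w] by blast
      then show ?thesis using True uw(2) by simp
    next
      case False
      then have "u \<in> N (r (m w))" using priv by blast
      then show ?thesis using N_sym r_m_S[OF w] by blast
    qed
  qed

  \<comment> \<open>If \<open>p\<close> were the only candidate, every edge of \<open>M\<close>
    meeting \<open>N u\<close> would have representative \<open>p\<close>. Then all \<open>d\<close>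
    neighbours of \<open>u\<close> would lie in the single edge \<open>m p\<close>, which has only 2
    vertices.\<close>
  have two: "\<exists>q. q \<in> N u \<inter> S \<and> q \<noteq> p" if "u \<in> U" for u p
  proof (rule ccontr)
    assume no: "\<not> ?thesis"
    have "N u \<subseteq> m p"
    proof
      fix w assume w: "w \<in> N u"
      then have wM: "w \<in> \<Union>M" using N_cov that by blast
      have "r (m w) = p" using no r_N[OF that w] by blast
      then have "p \<in> m w" using r[OF m(1)[OF wM]] by simp
      moreover from this have "p \<in> \<Union>M" using m(1)[OF wM] by blast
      ultimately have "m p = m w" using matching_eqI[OF M(1)] m wM by blast
      then show "w \<in> m p" using m[OF wM] by simp
    qed
    moreover have "card (N u) = d" using that card_N by (simp add: U_def)
    moreover obtain w where "w \<in> N u"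
      using \<open>card (N u) = d\<close> assms(2) by fastforce
    then have "p \<in> \<Union>M" using no r_N[OF that] S_cov by blast
    then have "card (m p) = 2" using m(1) ME G by (auto simp: simple_graph_def)
    then have "finite (m p)" by (simp add: card_ge_0_finite)
    ultimately show False using card_mono[of "m p" "N u"] \<open>card (m p) = 2\<close> assms(2) by simp
  qed

  \<comment> \<open>Vertices of \<open>W\<close> have all \<open>d\<close> neighbours in
    \<open>S\<close>, hence enough pairs for the counting argument; the rest of \<open>U\<close> is
    served by private neighbours.\<close>
  define W where "W = {u \<in> U. N u \<subseteq> S}"
  have "\<exists>R. inj_on R W \<and> (\<forall>u\<in>W. R u \<subseteq> N u \<and> card (R u) = 2)"
  proof (rule distinct_pairs)
    show "finite W" using finV by (simp add: W_def U_def)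
    show "finite (N u)" for u by (rule finN)
    show "d \<le> card (N u)" if "u \<in> W" for u using that card_N by (simp add: W_def U_def)
    show "card {u \<in> W. p \<in> N u} \<le> d" for p
    proof (cases "p \<in> V")
      case True
      have "{u \<in> W. p \<in> N u} \<subseteq> N p" using N_sym by blast
      from card_mono[OF finN this] show ?thesis unfolding card_N[OF True] .
    next
      case False
      then have "{u \<in> W. p \<in> N u} = {}" using N_sub by blast
      then show ?thesis by (simp only: card.empty zero_le)
    qed
  qed fact
  then obtain R where R: "inj_on R W" "\<And>u. u \<in> W \<Longrightarrow> R u \<subseteq> N u \<and> card (R u) = 2"
    by blast

  have "\<exists>P. P \<subseteq> N u \<inter> S \<and> card P = 2 \<and> (\<forall>v\<in>U. P \<subseteq> N v \<longrightarrow> v = u)" if u: "u \<in> U - W" for u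
  proof -
    obtain w where w: "w \<in> N u" "w \<notin> S" using u by (auto simp: W_def)
    define p where "p = r (m w)"
    have p: "p \<in> N u \<inter> S" "N p \<inter> U = {u}" using r_N r_priv w u by (auto simp: p_def)
    obtain q where "q \<in> N u \<inter> S" "q \<noteq> p" using two u by blast
    \<comment> \<open>Since \<open>u\<close> is the only neighbour of \<open>p\<close> in
      \<open>U\<close>, no other vertex of \<open>U\<close> has \<open>{p, q}\<close> inside its
      neighbourhood, whatever \<open>q\<close> is.\<close>
    then show ?thesis using p N_sym by (intro exI[of _ "{p, q}"]) auto
  qed
  then obtain Q where Q: "\<And>u. u \<in> U - W \<Longrightarrow> Q u \<subseteq> N u \<inter> S \<and> card (Q u) = 2"
    and Q_priv: "\<And>u v. u \<in> U - W \<Longrightarrow> v \<in> U \<Longrightarrow> Q u \<subseteq> N v \<Longrightarrow> v = u"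
    by metis

  define P where "P u = (if u \<in> W then R u else Q u)" for u
  have P: "P u \<subseteq> N u \<inter> S \<and> card (P u) = 2" if "u \<in> U" for u
    using that R(2)[of u] Q[of u] by (auto simp: P_def W_def)
  have "inj_on P U"
  proof (rule inj_onI)
    fix v w assume v: "v \<in> U" and w: "w \<in> U" and eq: "P v = P w"
    \<comment> \<open>Hall's theorem separates two vertices of \<open>W\<close>. As soon as one
      vertex lies outside \<open>W\<close>, its private pair cannot fit into the neighbourhood of
      the other.\<close>
    consider "v \<in> W" "w \<in> W" | "v \<in> U - W" | "w \<in> U - W" using v w by blast
    then show "v = w"
    proof cases
      case 1
      then show ?thesis using eq inj_onD[OF R(1)] by (simp add: P_def)
    next
      case 2
      then have "P v = Q v" by (simp add: P_def)
      then have "Q v \<subseteq> N w" using eq P[OF w] by blast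
      then show ?thesis using Q_priv[OF 2 w] by simp
    next
      case 3
      then have "P w = Q w" by (simp add: P_def)
      then have "Q w \<subseteq> N v" using eq P[OF v] by blast
      then show ?thesis using Q_priv[OF 3 v] by simp
    qed
  qed
  moreover have "s \<in> S \<and> {s, u} \<in> E" if "u \<in> U" "s \<in> P u" for u s
  proof -
    have "s \<in> S" "u \<in> N s" using P that N_sym by blast+
    then show ?thesis by (simp add: N_def)
  qed
  ultimately have "oriented_gamma_LD V E \<le> card M"
    using P oriented_gamma_LD_le_card_matching[OF G M(1) r, of P] unfolding U_def S_def by blast
  then show ?thesis using M(2) by simp
qed

end
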